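(* Let $\mathcal{C}$ be a tensor category satisfying Condition C (defined in the context), with contravariant functor $(-)^*$. Then for all objects $A,B\in\mathcal{C}$ the object $[A,B] = (A\otimes B^* )^*$ is an internal Hom from $A$ to $B$; that is, there is an isomorphism $\mathrm{Hom}(U\otimes A,B)\to\mathrm{Hom}(U,(A\otimes B^* )^* )$, natural in $U\in\mathcal{C}$.
   Context: A tensor category is a (not necessarily strict) monoidal category $(\mathcal{C},\otimes,\mathbf{1},\alpha,\lambda,\rho)$ with associator $\alpha_{U,V,W}:U\otimes(V\otimes W)\to(U\otimes V)\otimes W$ and unit isomorphisms $\lambda_U:\mathbf{1}\otimes U\to U$, $\rho_U:U\otimes\mathbf{1}\to U$, satisfying the pentagon and triangle axioms. Condition C: $\mathcal{C}$ is equipped with a contravariant involutive functor $(-)^*:\mathcal{C}\to\mathcal{C}$, meaning that there is a natural isomorphism $\delta_U:U\to U^{**}$ from the identity functor to the square of $(-)^*$, and with isomorphisms (bijections) $\pi_{U,V}:\mathrm{Hom}(U,V^* )\to\mathrm{Hom}(U\otimes V,\mathbf{1}^* )$ which are natural in $U$ and $V$. Internal Hom: given objects $A,B$ of a tensor category $\mathcal{C}$, an internal Hom from $A$ to $B$ is an object $[A,B]\in\mathcal{C}$ together with a natural isomorphism $\phi^{(A,B)}:\mathrm{Hom}(-\otimes A,B)\to\mathrm{Hom}(-,[A,B])$ of contravariant functors. *)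

theory Defs
  imports Main
begin

text \<open>Categories have explicit carriers of objects and arrows; composition is written in
  applicative order (\<open>g \<cdot> f\<close> is \<open>f\<close> followed by \<open>g\<close>) and is unspecified on non-composable pairs.\<close>

record ('o, 'a) cat =
  Obj   :: "'o set"
  Arr   :: "'a set"
  Dom   :: "'a \<Rightarrow> 'o"
  Cod   :: "'a \<Rightarrow> 'o"
  ident :: "'o \<Rightarrow> 'a"
  comp  :: "'a \<Rightarrow> 'a \<Rightarrow> 'a"  (infixl "\<cdot>\<index>" 70)

definition hom :: "('o, 'a, 'z) cat_scheme \<Rightarrow> 'o \<Rightarrow> 'o \<Rightarrow> 'a set" where
  "hom C A B = {f \<in> Arr C. Dom C f = A \<and> Cod C f = B}"

locale category =
  fixes C :: "('o, 'a, 'z) cat_scheme" (structure)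
  assumes Dom_closed: "f \<in> Arr C \<Longrightarrow> Dom C f \<in> Obj C"
    and Cod_closed: "f \<in> Arr C \<Longrightarrow> Cod C f \<in> Obj C"
    and ident_hom: "A \<in> Obj C \<Longrightarrow> ident C A \<in> hom C A A"
    and comp_hom: "f \<in> hom C A B \<Longrightarrow> g \<in> hom C B D \<Longrightarrow> g \<cdot> f \<in> hom C A D"
    and comp_ident: "f \<in> hom C A B \<Longrightarrow> f \<cdot> ident C A = f"
    and ident_comp: "f \<in> hom C A B \<Longrightarrow> ident C B \<cdot> f = f"
    and comp_assoc: "f \<in> hom C A B \<Longrightarrow> g \<in> hom C B D \<Longrightarrow> h \<in> hom C D E \<Longrightarrow>
      (h \<cdot> g) \<cdot> f = h \<cdot> (g \<cdot> f)"

definition iso_arr :: "('o, 'a, 'z) cat_scheme \<Rightarrow> 'o \<Rightarrow> 'o \<Rightarrow> 'a \<Rightarrow> bool" where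
  "iso_arr C A B f \<longleftrightarrow> f \<in> hom C A B \<and>
     (\<exists>g \<in> hom C B A. comp C g f = ident C A \<and> comp C f g = ident C B)"

definition op_cat :: "('o, 'a, 'z) cat_scheme \<Rightarrow> ('o, 'a) cat" where
  "op_cat C = \<lparr>Obj = Obj C, Arr = Arr C, Dom = Cod C, Cod = Dom C, ident = ident C,
     comp = (\<lambda>g f. comp C f g)\<rparr>"

definition prod_cat ::
  "('o, 'a, 'y) cat_scheme \<Rightarrow> ('p, 'b, 'z) cat_scheme \<Rightarrow> ('o \<times> 'p, 'a \<times> 'b) cat" where
  "prod_cat C D = \<lparr>Obj = Obj C \<times> Obj D, Arr = Arr C \<times> Arr D,
     Dom = (\<lambda>(f, g). (Dom C f, Dom D g)), Cod = (\<lambda>(f, g). (Cod C f, Cod D g)),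
     ident = (\<lambda>(A, B). (ident C A, ident D B)),
     comp = (\<lambda>(g, g') (f, f'). (comp C g f, comp D g' f'))\<rparr>"

record ('o, 'a, 'p, 'b) func =
  on_obj :: "'o \<Rightarrow> 'p"
  on_arr :: "'a \<Rightarrow> 'b"

locale is_functor = C: category C + D: category D
  for C :: "('o, 'a, 'y) cat_scheme" and D :: "('p, 'b, 'z) cat_scheme" +
  fixes F :: "('o, 'a, 'p, 'b) func"
  assumes on_obj_closed: "A \<in> Obj C \<Longrightarrow> on_obj F A \<in> Obj D"
    and on_arr_hom: "f \<in> hom C A B \<Longrightarrow> on_arr F f \<in> hom D (on_obj F A) (on_obj F B)"
    and on_arr_ident: "A \<in> Obj C \<Longrightarrow> on_arr F (ident C A) = ident D (on_obj F A)"
    and on_arr_comp: "f \<in> hom C A B \<Longrightarrow> g \<in> hom C B E \<Longrightarrow>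
      on_arr F (comp C g f) = comp D (on_arr F g) (on_arr F f)"

definition id_func :: "('o, 'a, 'o, 'a) func" where
  "id_func = \<lparr>on_obj = (\<lambda>A. A), on_arr = (\<lambda>f. f)\<rparr>"

definition comp_func ::
  "('p, 'b, 'q, 'c) func \<Rightarrow> ('o, 'a, 'p, 'b) func \<Rightarrow> ('o, 'a, 'q, 'c) func" where
  "comp_func G F = \<lparr>on_obj = (\<lambda>A. on_obj G (on_obj F A)), on_arr = (\<lambda>f. on_arr G (on_arr F f))\<rparr>"

locale natural_isomorphism = F: is_functor C D F + G: is_functor C D G
  for C :: "('o, 'a, 'y) cat_scheme" and D :: "('p, 'b, 'z) cat_scheme"
    and F G :: "('o, 'a, 'p, 'b) func" +
  fixes \<eta> :: "'o \<Rightarrow> 'b"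
  assumes component_iso: "A \<in> Obj C \<Longrightarrow> iso_arr D (on_obj F A) (on_obj G A) (\<eta> A)"
    and naturality: "f \<in> hom C A B \<Longrightarrow> comp D (\<eta> B) (on_arr F f) = comp D (on_arr G f) (\<eta> A)"

text \<open>Contravariant functors to sets. The map \<open>on_arr P f\<close> is only relevant on the set
  \<open>on_obj P B\<close>, where \<open>B\<close> is the codomain of \<open>f\<close>.\<close>

locale presheaf = C: category C for C :: "('o, 'a, 'z) cat_scheme" +
  fixes P :: "('o, 'a, 'x set, 'x \<Rightarrow> 'x) func"
  assumes presheaf_closed: "f \<in> hom C A B \<Longrightarrow> x \<in> on_obj P B \<Longrightarrow> on_arr P f x \<in> on_obj P A"
    and presheaf_ident: "A \<in> Obj C \<Longrightarrow> x \<in> on_obj P A \<Longrightarrow> on_arr P (ident C A) x = x"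
    and presheaf_comp: "f \<in> hom C A B \<Longrightarrow> g \<in> hom C B E \<Longrightarrow> x \<in> on_obj P E \<Longrightarrow>
      on_arr P (comp C g f) x = on_arr P f (on_arr P g x)"

locale natural_bijection = P: presheaf C P + Q: presheaf C Q
  for C :: "('o, 'a, 'z) cat_scheme"
    and P :: "('o, 'a, 'x set, 'x \<Rightarrow> 'x) func" and Q :: "('o, 'a, 'y set, 'y \<Rightarrow> 'y) func" +
  fixes \<phi> :: "'o \<Rightarrow> 'x \<Rightarrow> 'y"
  assumes component_bij: "A \<in> Obj C \<Longrightarrow> bij_betw (\<phi> A) (on_obj P A) (on_obj Q A)"
    and bij_naturality: "f \<in> hom C A B \<Longrightarrow> x \<in> on_obj P B \<Longrightarrow>
      \<phi> A (on_arr P f x) = on_arr Q f (\<phi> B x)"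

definition hom_into :: "('o, 'a, 'z) cat_scheme \<Rightarrow> 'o \<Rightarrow> ('o, 'a, 'a set, 'a \<Rightarrow> 'a) func" where
  "hom_into C B = \<lparr>on_obj = (\<lambda>U. hom C U B), on_arr = (\<lambda>f h. comp C h f)\<rparr>"

record ('o, 'a) tensor_cat = "('o, 'a) cat" +
  tensor     :: "('o \<times> 'o, 'a \<times> 'a, 'o, 'a) func"
  unit_obj   :: "'o"  ("\<one>\<index>")
  associator :: "'o \<times> 'o \<times> 'o \<Rightarrow> 'a"
  lunitor    :: "'o \<Rightarrow> 'a"
  runitor    :: "'o \<Rightarrow> 'a"

abbreviation tensor_obj ::
  "('o, 'a, 'z) tensor_cat_scheme \<Rightarrow> 'o \<Rightarrow> 'o \<Rightarrow> 'o" (infixl "\<otimes>\<index>" 75) where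
  "A \<otimes>\<^bsub>C\<^esub> B \<equiv> on_obj (tensor C) (A, B)"

abbreviation tensor_arr ::
  "('o, 'a, 'z) tensor_cat_scheme \<Rightarrow> 'a \<Rightarrow> 'a \<Rightarrow> 'a" (infixl "\<odot>\<index>" 75) where
  "f \<odot>\<^bsub>C\<^esub> g \<equiv> on_arr (tensor C) (f, g)"

text \<open>The associator goes from \<open>U \<otimes> (V \<otimes> W)\<close> to \<open>(U \<otimes> V) \<otimes> W\<close>.\<close>

locale tensor_category = category C
  for C :: "('o, 'a, 'z) tensor_cat_scheme" (structure) +
  assumes tensor_functor: "is_functor (prod_cat C C) C (tensor C)"
    and unit_closed: "\<one> \<in> Obj C"
    and associator_natural: "natural_isomorphism (prod_cat C (prod_cat C C)) C
      \<lparr>on_obj = (\<lambda>(U, V, W). U \<otimes> (V \<otimes> W)), on_arr = (\<lambda>(f, g, h). f \<odot> (g \<odot> h))\<rparr>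
      \<lparr>on_obj = (\<lambda>(U, V, W). (U \<otimes> V) \<otimes> W), on_arr = (\<lambda>(f, g, h). (f \<odot> g) \<odot> h)\<rparr>
      (associator C)"
    and lunitor_natural: "natural_isomorphism C C
      \<lparr>on_obj = (\<lambda>U. \<one> \<otimes> U), on_arr = (\<lambda>f. ident C \<one> \<odot> f)\<rparr> id_func (lunitor C)"
    and runitor_natural: "natural_isomorphism C C
      \<lparr>on_obj = (\<lambda>U. U \<otimes> \<one>), on_arr = (\<lambda>f. f \<odot> ident C \<one>)\<rparr> id_func (runitor C)"
    and pentagon: "U \<in> Obj C \<Longrightarrow> V \<in> Obj C \<Longrightarrow> W \<in> Obj C \<Longrightarrow> X \<in> Obj C \<Longrightarrow>
      associator C (U \<otimes> V, W, X) \<cdot> associator C (U, V, W \<otimes> X) =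
      (associator C (U, V, W) \<odot> ident C X) \<cdot> associator C (U, V \<otimes> W, X)
        \<cdot> (ident C U \<odot> associator C (V, W, X))"
    and triangle: "U \<in> Obj C \<Longrightarrow> V \<in> Obj C \<Longrightarrow>
      (runitor C U \<odot> ident C V) \<cdot> associator C (U, \<one>, V) = ident C U \<odot> lunitor C V"

text \<open>\<open>D\<close> is the contravariant functor \<open>(-)\<^sup>*\<close>, that is, a functor on the opposite category.
  The two hom-functors related by \<open>\<pi>\<close> are contravariant in \<open>U\<close> and in \<open>V\<close>, hence presheaves on
  the product category, and \<open>\<pi>\<close> is natural in both variables.\<close>

locale condition_C = tensor_category C
  for C :: "('o, 'a, 'z) tensor_cat_scheme" (structure) +
  fixes D :: "('o, 'a, 'o, 'a) func"
    and \<delta> :: "'o \<Rightarrow> 'a"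
    and \<pi> :: "'o \<times> 'o \<Rightarrow> 'a \<Rightarrow> 'a"
  assumes dual_functor: "is_functor (op_cat C) C D"
    and dual_involutive: "natural_isomorphism C C id_func (comp_func D D) \<delta>"
    and dual_hom: "natural_bijection (prod_cat C C)
      \<lparr>on_obj = (\<lambda>(U, V). hom C U (on_obj D V)), on_arr = (\<lambda>(f, g) h. on_arr D g \<cdot> h \<cdot> f)\<rparr>
      \<lparr>on_obj = (\<lambda>(U, V). hom C (U \<otimes> V) (on_obj D \<one>)), on_arr = (\<lambda>(f, g) h. h \<cdot> (f \<odot> g))\<rparr>
      \<pi>"

definition internal_hom ::
  "('o, 'a, 'z) tensor_cat_scheme \<Rightarrow> 'o \<Rightarrow> 'o \<Rightarrow> 'o \<Rightarrow> ('o \<Rightarrow> 'a \<Rightarrow> 'a) \<Rightarrow> bool" where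
  "internal_hom C A B H \<phi> \<longleftrightarrow> H \<in> Obj C \<and>
     natural_bijection C
       \<lparr>on_obj = (\<lambda>U. hom C (U \<otimes>\<^bsub>C\<^esub> A) B), on_arr = (\<lambda>f h. comp C h (f \<odot>\<^bsub>C\<^esub> ident C A))\<rparr>
       (hom_into C H) \<phi>"

end

theory Submission
  imports Defs
begin

text \<open>The bijection is the composite
  \<open>Hom(U \<otimes> A, B) \<rightarrow> Hom(U \<otimes> A, B\<^sup>*\<^sup>*) \<rightarrow> Hom((U \<otimes> A) \<otimes> B\<^sup>*, \<one>\<^sup>*) \<rightarrow> Hom(U \<otimes> (A \<otimes> B\<^sup>*), \<one>\<^sup>*)
  \<rightarrow> Hom(U, (A \<otimes> B\<^sup>*)\<^sup>*)\<close> of \<open>\<delta>\<^sub>B \<circ> -\<close>, \<open>\<pi>\<close>, precomposition with the associator, and \<open>\<pi>\<^sup>-\<^sup>1\<close>.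
  Each factor is natural in \<open>U\<close>.\<close>

section \<open>Functors, presheaves and natural bijections in general\<close>

lemma hom_objs:
  assumes "category C" "f \<in> hom C A B"
  shows "A \<in> Obj C" "B \<in> Obj C"
  using assms category.Dom_closed[OF assms(1)] category.Cod_closed[OF assms(1)]
  by (auto simp: hom_def)

lemma is_functor_comp_func:
  assumes "is_functor C D F" "is_functor D E G"
  shows "is_functor C E (comp_func G F)"
proof -
  interpret F: is_functor C D F by fact
  interpret G: is_functor D E G by fact
  show ?thesis
  proof unfold_locales
    fix f g X Y Z assume "f \<in> hom C X Y" "g \<in> hom C Y Z"
    then show "on_arr (comp_func G F) (comp C g f)
        = comp E (on_arr (comp_func G F) g) (on_arr (comp_func G F) f)"
      using G.on_arr_comp[OF F.on_arr_hom F.on_arr_hom]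
      by (simp add: comp_func_def F.on_arr_comp)
  qed (auto simp: comp_func_def F.on_arr_ident G.on_arr_ident F.on_obj_closed
      intro: G.on_obj_closed F.on_arr_hom G.on_arr_hom)
qed

lemma presheaf_comp_func:
  assumes "is_functor C D F" "presheaf D P"
  shows "presheaf C (comp_func P F)"
proof -
  interpret F: is_functor C D F by fact
  interpret P: presheaf D P by fact
  show ?thesis
    by unfold_locales
      (auto simp: comp_func_def F.on_arr_ident F.on_arr_comp P.presheaf_ident F.on_obj_closed
        intro: P.presheaf_closed P.presheaf_comp F.on_arr_hom)
qed

text \<open>Whiskering: the naturality square at \<open>f\<close> is that of \<open>\<phi>\<close>
  at \<open>on_arr F f\<close>. With F the functor tensoring on the right by A, a bijection natural
  in all objects becomes one natural in U at the object U \<otimes> A.\<close>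

lemma natural_bijection_comp_func:
  assumes "is_functor C D F" "natural_bijection D P Q \<phi>"
  shows "natural_bijection C (comp_func P F) (comp_func Q F) (\<lambda>U. \<phi> (on_obj F U))"
proof -
  interpret F: is_functor C D F by fact
  interpret N: natural_bijection D P Q \<phi> by fact
  show ?thesis
  proof (intro natural_bijection.intro natural_bijection_axioms.intro)
    show "presheaf C (comp_func P F)" "presheaf C (comp_func Q F)"
      using presheaf_comp_func[OF assms(1)] N.P.presheaf_axioms N.Q.presheaf_axioms by auto
  qed (auto simp: comp_func_def intro: N.component_bij N.bij_naturality F.on_obj_closed F.on_arr_hom)
qed

lemma natural_bijection_trans:
  assumes "natural_bijection C P Q \<phi>" "natural_bijection C Q R \<psi>"
  shows "natural_bijection C P R (\<lambda>U. \<psi> U \<circ> \<phi> U)"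
proof -
  interpret N: natural_bijection C P Q \<phi> by fact
  interpret M: natural_bijection C Q R \<psi> by fact
  show ?thesis
  proof unfold_locales
    fix f A B x assume f: "f \<in> hom C A B" and x: "x \<in> on_obj P B"
    \<comment> \<open>Naturality of \<open>\<psi>\<close> is asserted only on elements of
      \<open>on_obj Q B\<close>, so membership comes first.\<close>
    have "\<phi> B x \<in> on_obj Q B"
      using N.component_bij hom_objs(2)[OF N.P.C.category_axioms f] x by (blast dest: bij_betwE)
    then show "(\<psi> A \<circ> \<phi> A) (on_arr P f x) = on_arr R f ((\<psi> B \<circ> \<phi> B) x)"
      using f x by (simp add: N.bij_naturality M.bij_naturality)
  qed (rule bij_betw_trans[OF N.component_bij M.component_bij])
qed

lemma natural_bijection_inv:
  assumes "natural_bijection C P Q \<phi>"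
  shows "natural_bijection C Q P (\<lambda>U. inv_into (on_obj P U) (\<phi> U))"
proof -
  interpret N: natural_bijection C P Q \<phi> by fact
  show ?thesis
  proof unfold_locales
    fix f A B y assume f: "f \<in> hom C A B" and y: "y \<in> on_obj Q B"
    have bij: "bij_betw (\<phi> A) (on_obj P A) (on_obj Q A)" "bij_betw (\<phi> B) (on_obj P B) (on_obj Q B)"
      using N.component_bij hom_objs[OF N.P.C.category_axioms f] by auto
    then obtain x where x: "x \<in> on_obj P B" "y = \<phi> B x"
      using y by (blast dest: bij_betw_imp_surj_on)
    \<comment> \<open>With y = \<open>\<phi> B x\<close>, naturality of \<open>\<phi>\<close> read
      from right to left turns \<open>on_arr Q f y\<close> into
      \<open>\<phi> A (on_arr P f x)\<close>; both inverses then cancel on the left.\<close>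
    then show "inv_into (on_obj P A) (\<phi> A) (on_arr Q f y) = on_arr P f (inv_into (on_obj P B) (\<phi> B) y)"
      using bij f N.P.presheaf_closed[OF f]
      by (simp add: bij_betw_inv_into_left flip: N.bij_naturality)
  qed (rule bij_betw_inv_into[OF N.component_bij])
qed

section \<open>Hom presheaves and composition with isomorphisms\<close>

context category
begin

lemma presheaf_hom_into: "presheaf C (hom_into C B)"
  by unfold_locales
    (auto simp: hom_into_def comp_ident intro: comp_hom comp_assoc[symmetric])

lemma bij_betw_comp_left:
  assumes "iso_arr C A B f"
  shows "bij_betw (\<lambda>h. f \<cdot> h) (hom C U A) (hom C U B)"
proof -
  obtain g where g: "f \<in> hom C A B" "g \<in> hom C B A" "g \<cdot> f = ident C A" "f \<cdot> g = ident C B"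
    using assms by (auto simp: iso_arr_def)
  show ?thesis
    by (rule bij_betw_byWitness[where f' = "\<lambda>h. g \<cdot> h"])
      (use g in \<open>auto simp: ident_comp comp_assoc[symmetric] intro: comp_hom\<close>)
qed

lemma bij_betw_comp_right:
  assumes "iso_arr C A B f"
  shows "bij_betw (\<lambda>h. h \<cdot> f) (hom C B V) (hom C A V)"
proof -
  obtain g where g: "f \<in> hom C A B" "g \<in> hom C B A" "g \<cdot> f = ident C A" "f \<cdot> g = ident C B"
    using assms by (auto simp: iso_arr_def)
  show ?thesis
    by (rule bij_betw_byWitness[where f' = "\<lambda>h. h \<cdot> g"])
      (use g in \<open>auto simp: comp_ident comp_assoc intro: comp_hom\<close>)
qed

text \<open>Bijectivity comes from the inverse arrow of f, and naturality in U is associativity of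
  composition. It is applied to \<open>\<delta> B\<close>.\<close>

lemma natural_bijection_hom_into_iso:
  assumes "iso_arr C A B f"
  shows "natural_bijection C (hom_into C A) (hom_into C B) (\<lambda>U h. f \<cdot> h)"
proof (intro natural_bijection.intro natural_bijection_axioms.intro presheaf_hom_into)
  show "bij_betw (\<lambda>h. f \<cdot> h) (on_obj (hom_into C A) U) (on_obj (hom_into C B) U)" for U
    using bij_betw_comp_left[OF assms] by (simp add: hom_into_def)
  show "f \<cdot> on_arr (hom_into C A) g h = on_arr (hom_into C B) g (f \<cdot> h)"
    if "g \<in> hom C U V" "h \<in> on_obj (hom_into C A) V" for g h U V
    using that assms by (auto simp: hom_into_def iso_arr_def comp_assoc)
qed

end

text \<open>Contravariance of Hom(-, B) reverses the direction: \<open>\<eta>\<close> goes from F to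
  G, the bijection from Hom(G -, B) to Hom(F -, B). Its naturality is the square of
  \<open>\<eta>\<close> placed between two reassociations.\<close>

lemma natural_bijection_precomp:
  assumes "natural_isomorphism E C F G \<eta>"
  shows "natural_bijection E (comp_func (hom_into C B) G) (comp_func (hom_into C B) F)
    (\<lambda>U h. comp C h (\<eta> U))"
proof -
  interpret N: natural_isomorphism E C F G \<eta> by fact
  let ?G = "comp_func (hom_into C B) G" and ?F = "comp_func (hom_into C B) F"
  show ?thesis
  proof (intro natural_bijection.intro natural_bijection_axioms.intro)
    show "presheaf E ?G" "presheaf E ?F"
      by (rule presheaf_comp_func[OF _ N.F.D.presheaf_hom_into],
          rule N.G.is_functor_axioms N.F.is_functor_axioms)+
  next
    show "bij_betw (\<lambda>h. comp C h (\<eta> U)) (on_obj ?G U) (on_obj ?F U)" if "U \<in> Obj E" for U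
      using N.F.D.bij_betw_comp_right[OF N.component_iso[OF that]]
      by (simp add: hom_into_def comp_func_def)
  next
    fix f U V h assume f: "f \<in> hom E U V" and h: "h \<in> on_obj ?G V"
    have \<eta>: "\<eta> W \<in> hom C (on_obj F W) (on_obj G W)" if "W \<in> {U, V}" for W
      using N.component_iso that hom_objs[OF N.F.C.category_axioms f] by (auto simp: iso_arr_def)
    have h': "h \<in> hom C (on_obj G V) B"
      using h by (simp add: hom_into_def comp_func_def)
    have "comp C (comp C h (on_arr G f)) (\<eta> U) = comp C h (comp C (on_arr G f) (\<eta> U))"
      by (rule N.F.D.comp_assoc[OF \<eta> N.G.on_arr_hom[OF f] h']) simp
    also have "\<dots> = comp C (comp C h (\<eta> V)) (on_arr F f)"
      using N.F.D.comp_assoc[OF N.F.on_arr_hom[OF f] \<eta> h'] N.naturality[OF f] by simp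
    finally show "comp C (on_arr ?G f h) (\<eta> U) = on_arr ?F f (comp C h (\<eta> V))"
      by (simp add: hom_into_def comp_func_def)
  qed
qed

section \<open>Tensoring on the right by a fixed object\<close>

lemma prod_cat_simps:
  "Obj (prod_cat C D) = Obj C \<times> Obj D"
  "(f, f') \<in> hom (prod_cat C D) (A, B) (A', B') \<longleftrightarrow> f \<in> hom C A A' \<and> f' \<in> hom D B B'"
  "comp (prod_cat C D) (g, g') (f, f') = (comp C g f, comp D g' f')"
  "ident (prod_cat C D) (A, B) = (ident C A, ident D B)"
  by (auto simp: prod_cat_def hom_def)

text \<open>With this functor the source presheaf of an internal Hom from A to B is
  \<open>hom_into C B\<close> composed with \<open>tensor_right C A\<close>, so the lemmas on
  composite functors apply to it.\<close>

definition tensor_right ::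
  "('o, 'a, 'z) tensor_cat_scheme \<Rightarrow> 'o \<Rightarrow> ('o, 'a, 'o, 'a) func" where
  "tensor_right C V = \<lparr>on_obj = (\<lambda>U. U \<otimes>\<^bsub>C\<^esub> V), on_arr = (\<lambda>f. f \<odot>\<^bsub>C\<^esub> ident C V)\<rparr>"

context tensor_category
begin

text \<open>Fixing V and W in the associator leaves \<open>ident C V \<odot> ident C W\<close> on
  arrows; this equation turns it into the identity that
  \<open>tensor_right C (V \<otimes> W)\<close> uses.\<close>

lemma ident_tensor_ident:
  assumes "U \<in> Obj C" "V \<in> Obj C"
  shows "ident C U \<odot> ident C V = ident C (U \<otimes> V)"
  using is_functor.on_arr_ident[OF tensor_functor, of "(U, V)"] assms by (simp add: prod_cat_simps)

lemma is_functor_tensor_right: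
  assumes V: "V \<in> Obj C"
  shows "is_functor C C (tensor_right C V)"
proof -
  interpret T: is_functor "prod_cat C C" C "tensor C" by (rule tensor_functor)
  note idV = ident_hom[OF V]
  show ?thesis
  proof unfold_locales
    fix f g X Y Z assume "f \<in> hom C X Y" "g \<in> hom C Y Z"
    then show "on_arr (tensor_right C V) (g \<cdot> f)
        = on_arr (tensor_right C V) g \<cdot> on_arr (tensor_right C V) f"
      \<comment> \<open>In the second coordinate \<open>ident C V\<close> is composed with itself,
        which \<open>comp_ident\<close> collapses.\<close>
      using T.on_arr_comp[of "(f, ident C V)" "(X, V)" "(Y, V)" "(g, ident C V)" "(Z, V)"] idV
      by (simp add: prod_cat_simps tensor_right_def comp_ident[OF idV])
  qed (use V idV in \<open>auto simp: tensor_right_def ident_tensor_ident prod_cat_simps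
      intro!: T.on_obj_closed T.on_arr_hom\<close>)
qed

lemma tensor_closed: "U \<in> Obj C \<Longrightarrow> V \<in> Obj C \<Longrightarrow> U \<otimes> V \<in> Obj C"
  using is_functor.on_obj_closed[OF is_functor_tensor_right] by (simp add: tensor_right_def)

text \<open>The restriction of the associator to triples with fixed V and W, its naturality being
  tested on arrows \<open>(f, ident C V, ident C W)\<close>.\<close>

lemma associator_natural_left:
  assumes V: "V \<in> Obj C" and W: "W \<in> Obj C"
  shows "natural_isomorphism C C (tensor_right C (V \<otimes> W))
    (comp_func (tensor_right C W) (tensor_right C V)) (\<lambda>U. associator C (U, V, W))"
proof -
  interpret V_W: is_functor C C "comp_func (tensor_right C W) (tensor_right C V)"
    by (rule is_functor_comp_func[OF is_functor_tensor_right[OF V] is_functor_tensor_right[OF W]])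
  interpret VW: is_functor C C "tensor_right C (V \<otimes> W)"
    by (intro is_functor_tensor_right tensor_closed V W)
  interpret a: natural_isomorphism "prod_cat C (prod_cat C C)" C
      "\<lparr>on_obj = (\<lambda>(U, V, W). U \<otimes> (V \<otimes> W)), on_arr = (\<lambda>(f, g, h). f \<odot> (g \<odot> h))\<rparr>"
      "\<lparr>on_obj = (\<lambda>(U, V, W). (U \<otimes> V) \<otimes> W), on_arr = (\<lambda>(f, g, h). (f \<odot> g) \<odot> h)\<rparr>"
      "associator C"
    by (rule associator_natural)
  show ?thesis
  proof unfold_locales
    fix f X Y assume "f \<in> hom C X Y"
    then have "(f, ident C V, ident C W) \<in> hom (prod_cat C (prod_cat C C)) (X, V, W) (Y, V, W)"
      by (simp add: prod_cat_simps ident_hom V W)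
    from a.naturality[OF this] show "associator C (Y, V, W) \<cdot> on_arr (tensor_right C (V \<otimes> W)) f
      = on_arr (comp_func (tensor_right C W) (tensor_right C V)) f \<cdot> associator C (X, V, W)"
      by (simp add: tensor_right_def comp_func_def ident_tensor_ident V W)
  next
    fix U assume "U \<in> Obj C"
    then show "iso_arr C (on_obj (tensor_right C (V \<otimes> W)) U)
        (on_obj (comp_func (tensor_right C W) (tensor_right C V)) U) (associator C (U, V, W))"
      using a.component_iso[of "(U, V, W)"] V W
      by (simp add: prod_cat_simps tensor_right_def comp_func_def)
  qed
qed

end

section \<open>Consequences of the duality\<close>

context condition_C
begin

lemma dual_closed: "U \<in> Obj C \<Longrightarrow> on_obj D U \<in> Obj C"
  using is_functor.on_obj_closed[OF dual_functor] by (simp add: op_cat_def)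

lemma dual_ident: "U \<in> Obj C \<Longrightarrow> on_arr D (ident C U) = ident C (on_obj D U)"
  using is_functor.on_arr_ident[OF dual_functor] by (simp add: op_cat_def)

lemma double_dual_iso: "U \<in> Obj C \<Longrightarrow> iso_arr C U (on_obj D (on_obj D U)) (\<delta> U)"
  using natural_isomorphism.component_iso[OF dual_involutive]
  by (simp add: id_func_def comp_func_def)

text \<open>The dual of V represents the presheaf of arrows from - \<otimes> V to the dual of the
  unit. This form of \<open>\<pi>\<close>, natural in U alone, is used forwards at the dual of B and
  backwards at A \<otimes> \<open>on_obj D B\<close>.\<close>

lemma dual_hom_left:
  assumes V: "V \<in> Obj C"
  shows "natural_bijection C (hom_into C (on_obj D V))
    (comp_func (hom_into C (on_obj D \<one>)) (tensor_right C V)) (\<lambda>U. \<pi> (U, V))"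
proof -
  interpret \<pi>: natural_bijection "prod_cat C C"
      "\<lparr>on_obj = (\<lambda>(U, V). hom C U (on_obj D V)), on_arr = (\<lambda>(f, g) h. on_arr D g \<cdot> h \<cdot> f)\<rparr>"
      "\<lparr>on_obj = (\<lambda>(U, V). hom C (U \<otimes> V) (on_obj D \<one>)), on_arr = (\<lambda>(f, g) h. h \<cdot> (f \<odot> g))\<rparr>"
      \<pi>
    by (rule dual_hom)
  let ?P = "hom_into C (on_obj D V)"
    and ?Q = "comp_func (hom_into C (on_obj D \<one>)) (tensor_right C V)"
  show ?thesis
  proof (intro natural_bijection.intro natural_bijection_axioms.intro)
    show "presheaf C ?P" by (rule presheaf_hom_into)
    show "presheaf C ?Q"
      by (rule presheaf_comp_func[OF is_functor_tensor_right[OF V] presheaf_hom_into])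
  next
    show "bij_betw (\<pi> (U, V)) (on_obj ?P U) (on_obj ?Q U)" if "U \<in> Obj C" for U
      using \<pi>.component_bij[of "(U, V)"] V that
      by (simp add: prod_cat_simps hom_into_def comp_func_def tensor_right_def)
  next
    fix f X Y h assume "f \<in> hom C X Y" "h \<in> on_obj ?P Y"
    then show "\<pi> (X, V) (on_arr ?P f h) = on_arr ?Q f (\<pi> (Y, V) h)"
      \<comment> \<open>Since D preserves identities, the factor \<open>on_arr D (ident C V)\<close>
        is an identity and drops out on the left of h.\<close>
      using \<pi>.bij_naturality[of "(f, ident C V)" "(X, V)" "(Y, V)" h] ident_hom[OF V] V
      by (simp add: prod_cat_simps hom_into_def comp_func_def tensor_right_def dual_ident ident_comp)
  qed
qed

end

theorem theorem3p3:
  fixes C :: "('o, 'a, 'z) tensor_cat_scheme" (structure)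
    and D :: "('o, 'a, 'o, 'a) func"
    and \<delta> :: "'o \<Rightarrow> 'a"
    and \<pi> :: "'o \<times> 'o \<Rightarrow> 'a \<Rightarrow> 'a"
    and A B :: "'o"
  assumes "condition_C C D \<delta> \<pi>"
    and "A \<in> Obj C" and "B \<in> Obj C"
  shows "\<exists>\<phi>. internal_hom C A B (on_obj D (A \<otimes> on_obj D B)) \<phi>"
proof -
  interpret condition_C C D \<delta> \<pi> by fact
  let ?B' = "on_obj D B"
  let ?RA = "tensor_right C A" and ?RB = "tensor_right C ?B'"
    and ?RAB = "tensor_right C (A \<otimes> ?B')"
  let ?H = "hom_into C (on_obj D \<one>)"
  have B': "?B' \<in> Obj C" and AB': "A \<otimes> ?B' \<in> Obj C"
    using assms(2,3) by (auto intro: dual_closed tensor_closed)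
  note RA = is_functor_tensor_right[OF assms(2)]
  have 1: "natural_bijection C (comp_func (hom_into C B) ?RA)
      (comp_func (hom_into C (on_obj D ?B')) ?RA) (\<lambda>U h. \<delta> B \<cdot> h)"
    using natural_bijection_comp_func[OF RA]
      natural_bijection_hom_into_iso[OF double_dual_iso[OF assms(3)]] by blast
  have 2: "natural_bijection C (comp_func (hom_into C (on_obj D ?B')) ?RA)
      (comp_func ?H (comp_func ?RB ?RA)) (\<lambda>U. \<pi> (on_obj ?RA U, ?B'))"
    \<comment> \<open>Whiskering brackets the target as (\<open>?H\<close> after \<open>?RB\<close>)
      after \<open>?RA\<close>; unfolding \<open>comp_func_def\<close> rebrackets it so that the
      associator can act on the composite of the two tensor functors.\<close>
    using natural_bijection_comp_func[OF RA dual_hom_left[OF B']]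
    by (simp add: comp_func_def)
  have 3: "natural_bijection C (comp_func ?H (comp_func ?RB ?RA)) (comp_func ?H ?RAB)
      (\<lambda>U h. h \<cdot> associator C (U, A, ?B'))"
    by (rule natural_bijection_precomp[OF associator_natural_left[OF assms(2) B']])
  obtain \<phi> where "natural_bijection C (comp_func (hom_into C B) ?RA)
      (hom_into C (on_obj D (A \<otimes> ?B'))) \<phi>"
    \<comment> \<open>The last factor is the inverse of \<open>\<pi>\<close> with second argument
      \<open>A \<otimes> ?B'\<close>, whose dual is the claimed internal Hom.\<close>
    using natural_bijection_trans[OF natural_bijection_trans[OF natural_bijection_trans[OF 1 2] 3]
        natural_bijection_inv[OF dual_hom_left[OF AB']]] by blast
  then show ?thesis
    using dual_closed[OF AB']
    by (auto simp: internal_hom_def comp_func_def hom_into_def tensor_right_def)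
qed

end
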